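(* Let $k$ be a positive integer and let $\mathcal{H}$ be a $1$-intersecting $k$-graph that is not a sunflower. Then \[ \mathrm{Ord} (\mathcal{H}) + \mathrm{Ker} (\mathcal{H}) \le \frac{4}{27}k^3 + 4k^{5/2}. \]
   Context: A $k$-graph is a $k$-uniform hypergraph. A hypergraph is $1$-intersecting if every pair of distinct edges shares exactly one vertex; it is intersecting if every pair of distinct edges shares at least one vertex. A hypergraph $\mathcal{H}$ is a sunflower if $e_1\cap e_2=\bigcap_{e\in E(\mathcal{H})} e$ for all distinct edges $e_1,e_2$. The order $\mathrm{Ord}(\mathcal{H})$ is the number of non-isolated vertices. For an intersecting hypergraph $\mathcal{H}$, a set $A\subseteq V(\mathcal{H})$ is a kernel if (i) $A\cap e\neq\varnothing$ for every edge $e$, and (ii) the hypergraph on vertex set $A$ with edges $\{A\cap e: e\in E(\mathcal{H})\}$ is intersecting. $\mathrm{Ker}(\mathcal{H})$ denotes the minimum size of a kernel of $\mathcal{H}$. *)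

theory Defs
  imports Complex_Main
begin

record 'a hypergraph =
  verts :: "'a set"
  edges :: "'a set set"

definition hypergraph :: "'a hypergraph \<Rightarrow> bool" where
  "hypergraph H \<longleftrightarrow> (\<forall>e\<in>edges H. e \<subseteq> verts H)"

definition k_graph :: "nat \<Rightarrow> 'a hypergraph \<Rightarrow> bool" where
  "k_graph k H \<longleftrightarrow> hypergraph H \<and> (\<forall>e\<in>edges H. finite e \<and> card e = k)"

definition intersecting :: "'a hypergraph \<Rightarrow> bool" where
  "intersecting H \<longleftrightarrow> (\<forall>e\<in>edges H. \<forall>f\<in>edges H. e \<noteq> f \<longrightarrow> e \<inter> f \<noteq> {})"

definition one_intersecting :: "'a hypergraph \<Rightarrow> bool" where
  "one_intersecting H \<longleftrightarrow> (\<forall>e\<in>edges H. \<forall>f\<in>edges H. e \<noteq> f \<longrightarrow> card (e \<inter> f) = 1)"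

text \<open>With fewer than two edges the condition is vacuous, so such a hypergraph is a sunflower.\<close>

definition sunflower :: "'a hypergraph \<Rightarrow> bool" where
  "sunflower H \<longleftrightarrow> (\<forall>e\<in>edges H. \<forall>f\<in>edges H. e \<noteq> f \<longrightarrow> e \<inter> f = \<Inter>(edges H))"

definition isolated :: "'a hypergraph \<Rightarrow> 'a \<Rightarrow> bool" where
  "isolated H v \<longleftrightarrow> (\<forall>e\<in>edges H. v \<notin> e)"

definition Ord :: "'a hypergraph \<Rightarrow> nat" where
  "Ord H = card {v \<in> verts H. \<not> isolated H v}"

definition trace :: "'a hypergraph \<Rightarrow> 'a set \<Rightarrow> 'a hypergraph" where
  "trace H A = \<lparr>verts = A, edges = {A \<inter> e | e. e \<in> edges H}\<rparr>"

definition kernel :: "'a hypergraph \<Rightarrow> 'a set \<Rightarrow> bool" where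
  "kernel H A \<longleftrightarrow> A \<subseteq> verts H \<and> (\<forall>e\<in>edges H. A \<inter> e \<noteq> {}) \<and> intersecting (trace H A)"

text \<open>
  The vertex set is not required to be finite. Infinite kernels, whose \<open>card\<close> would be 0, are
  therefore excluded explicitly. The two facts at the end show that neither \<open>Ord\<close> nor \<open>Ker\<close>
  takes a default value on a 1-intersecting \<open>k\<close>-graph that is not a sunflower.
\<close>

definition Ker :: "'a hypergraph \<Rightarrow> nat" where
  "Ker H = (LEAST n. \<exists>A. kernel H A \<and> finite A \<and> card A = n)"

lemma finite_edges:
  assumes "k_graph k H" "one_intersecting H" "\<not> sunflower H"
  shows "finite (edges H)"
proof -
  have star: "finite {e \<in> edges H. v \<in> e}" for v
  proof -
    have "\<exists>f\<in>edges H. v \<notin> f"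
    proof (rule ccontr)
      assume "\<not> ?thesis"
      hence all: "\<And>f. f \<in> edges H \<Longrightarrow> v \<in> f" by blast
      have eq: "e \<inter> f = {v}" if "e \<in> edges H" "f \<in> edges H" "e \<noteq> f" for e f
      proof -
        have "card (e \<inter> f) = 1" using assms(2) that by (auto simp: one_intersecting_def)
        then obtain x where "e \<inter> f = {x}" by (auto simp: card_1_singleton_iff)
        moreover have "v \<in> e \<inter> f" using all that by simp
        ultimately show ?thesis by simp
      qed
      have "sunflower H" unfolding sunflower_def
      proof (intro ballI impI)
        fix e f assume ef: "e \<in> edges H" "f \<in> edges H" "e \<noteq> f"
        have "\<Inter>(edges H) \<subseteq> e \<inter> f" using ef by blast
        moreover have "v \<in> \<Inter>(edges H)" using all by simp
        ultimately show "e \<inter> f = \<Inter>(edges H)" using eq[OF ef] by auto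
      qed
      thus False using assms(3) by blast
    qed
    then obtain f where f: "f \<in> edges H" "v \<notin> f" by blast
    have ex: "\<exists>x. e \<inter> f = {x}" if "e \<in> edges H" "v \<in> e" for e
    proof -
      have "e \<noteq> f" using that f by auto
      hence "card (e \<inter> f) = 1" using assms(2) that f by (simp add: one_intersecting_def)
      thus ?thesis by (simp add: card_1_singleton_iff)
    qed
    define g where "g e = (THE x. e \<inter> f = {x})" for e
    have g: "e \<inter> f = {g e}" if "e \<in> edges H" "v \<in> e" for e
      using ex[OF that] unfolding g_def by auto
    have "inj_on g {e \<in> edges H. v \<in> e}"
    proof (rule inj_onI, rule ccontr)
      fix a b assume ab: "a \<in> {e \<in> edges H. v \<in> e}" "b \<in> {e \<in> edges H. v \<in> e}"
        "g a = g b" "a \<noteq> b"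
      have "g a \<in> a \<inter> b" "g a \<in> f" using g[of a] g[of b] ab by auto
      moreover have "v \<in> a \<inter> b" using ab by blast
      moreover have "card (a \<inter> b) = 1" using assms(2) ab by (auto simp: one_intersecting_def)
      moreover obtain x where "a \<inter> b = {x}" using calculation(4) by (auto simp: card_1_singleton_iff)
      ultimately have "g a = v" by simp
      thus False using \<open>g a \<in> f\<close> f(2) by simp
    qed
    moreover have "g ` {e \<in> edges H. v \<in> e} \<subseteq> f" using g by auto
    moreover have "finite f" using assms(1) f by (auto simp: k_graph_def)
    ultimately show ?thesis by (rule inj_on_finite)
  qed
  obtain d where d: "d \<in> edges H" using assms(3) by (auto simp: sunflower_def)
  have "edges H \<subseteq> insert d (\<Union>v\<in>d. {e \<in> edges H. v \<in> e})"
  proof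
    fix e assume e: "e \<in> edges H"
    show "e \<in> insert d (\<Union>v\<in>d. {e \<in> edges H. v \<in> e})"
    proof (cases "e = d")
      case False
      hence "card (e \<inter> d) = 1" using assms(2) e d by (auto simp: one_intersecting_def)
      hence "e \<inter> d \<noteq> {}" by auto
      thus ?thesis using e by blast
    qed simp
  qed
  moreover have "finite d" using assms(1) d by (auto simp: k_graph_def)
  hence "finite (insert d (\<Union>v\<in>d. {e \<in> edges H. v \<in> e}))" using star by simp
  ultimately show ?thesis by (rule finite_subset)
qed

lemma finite_non_isolated:
  assumes "k_graph k H" "one_intersecting H" "\<not> sunflower H"
  shows "finite {v \<in> verts H. \<not> isolated H v}"
proof -
  have "{v \<in> verts H. \<not> isolated H v} \<subseteq> \<Union>(edges H)" by (auto simp: isolated_def)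
  moreover have "finite (\<Union>(edges H))"
    using finite_edges[OF assms] assms(1) by (auto simp: k_graph_def)
  ultimately show ?thesis by (rule finite_subset)
qed

lemma Ker_attained:
  assumes "0 < k" "k_graph k H" "one_intersecting H" "\<not> sunflower H"
  shows "\<exists>A. kernel H A \<and> finite A \<and> card A = Ker H"
proof -
  let ?A = "{v \<in> verts H. \<not> isolated H v}"
  have tr: "?A \<inter> e = e" if "e \<in> edges H" for e
    using that assms(2) by (auto simp: k_graph_def hypergraph_def isolated_def)
  have ne: "e \<noteq> {}" if "e \<in> edges H" for e
    using that assms(1,2) by (auto simp: k_graph_def)
  have "{?A \<inter> e | e. e \<in> edges H} = (\<lambda>e. ?A \<inter> e) ` edges H" by (rule Setcompr_eq_image)
  also have "\<dots> = (\<lambda>e. e) ` edges H" by (intro image_cong refl tr)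
  finally have "edges (trace H ?A) = edges H" by (simp add: trace_def)
  hence "intersecting (trace H ?A)"
    using assms(3) by (fastforce simp: intersecting_def one_intersecting_def)
  hence "kernel H ?A" unfolding kernel_def by (simp add: tr ne subset_iff)
  hence "\<exists>n A. kernel H A \<and> finite A \<and> card A = n"
    using finite_non_isolated[OF assms(2-4)] by blast
  thus ?thesis unfolding Ker_def by (rule LeastI_ex)
qed

end

theory Submission
  imports Defs
begin

text \<open>
  A kernel of a 1-intersecting hypergraph is a set containing all vertices of degree at least 2.
  Hence, with \<open>m\<close> edges and \<open>S\<close> the sum of \<open>d(v) - 2\<close> over the vertices of degree
  \<open>d(v) \<ge> 2\<close>, double counting gives \<open>Ord + Ker \<le> k m - S\<close>. Let \<open>x\<close> be the square root of \<open>m\<close>.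
  If all degrees are at most \<open>x\<close>, the identity \<open>\<Sum> d(v) (d(v) - 1) = m (m - 1)\<close> yields
  \<open>x S \<ge> m (m - 1) - k m\<close>. If some vertex has degree \<open>D > x\<close>, the \<open>D\<close> edges through it are disjoint
  elsewhere and each of them meets the other \<open>m - D\<close> edges there, so
  \<open>S \<ge> D (m - D - k)\<close>. As \<open>x, D \<le> k\<close>, either way \<open>S \<ge> x\<^sup>3 - 2 k\<^sup>2\<close>, and
  \<open>k x\<^sup>2 - x\<^sup>3 \<le> 4/27 k\<^sup>3\<close>.
\<close>

section \<open>Incidence counting\<close>

definition degree :: "'a hypergraph \<Rightarrow> 'a \<Rightarrow> nat" where
  "degree H v = card {e \<in> edges H. v \<in> e}"

lemma sum_edges_sum_verts:
  fixes g :: "'a \<Rightarrow> nat"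
  assumes "finite (edges H)" "\<And>e. e \<in> edges H \<Longrightarrow> finite e"
  shows "(\<Sum>e\<in>edges H. \<Sum>v\<in>e. g v) = (\<Sum>v\<in>\<Union>(edges H). degree H v * g v)"
proof -
  let ?U = "\<Union>(edges H)"
  have finU: "finite ?U" using assms by blast
  have "(\<Sum>e\<in>edges H. \<Sum>v\<in>e. g v) = (\<Sum>e\<in>edges H. \<Sum>v\<in>{v\<in>?U. v \<in> e}. g v)"
    by (intro sum.cong) auto
  also have "\<dots> = (\<Sum>v\<in>?U. \<Sum>e\<in>{e\<in>edges H. v \<in> e}. g v)"
    by (rule sum.swap_restrict) (use assms finU in auto)
  finally show ?thesis by (simp add: degree_def)
qed

locale one_intersecting_non_sunflower =
  fixes k :: nat and H :: "'a hypergraph"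
  assumes k_graph: "k_graph k H"
    and one_intersecting: "one_intersecting H"
    and non_sunflower: "\<not> sunflower H"
begin

abbreviation "U \<equiv> \<Union>(edges H)"
abbreviation "m \<equiv> card (edges H)"
text \<open>Truncated subtraction lets vertices of degree 1 contribute 0, so only degrees above 2
  count.\<close>

abbreviation "S \<equiv> \<Sum>v\<in>U. degree H v - 2"

lemma fin_edges [simp]: "finite (edges H)"
  using finite_edges k_graph one_intersecting non_sunflower by blast

lemma edges_nonempty: "edges H \<noteq> {}"
  using non_sunflower by (auto simp: sunflower_def)

lemma finite_edge [simp]: "e \<in> edges H \<Longrightarrow> finite e"
  and card_edge: "e \<in> edges H \<Longrightarrow> card e = k"
  using k_graph by (auto simp: k_graph_def)

lemma finite_U: "finite U"
  by auto

section \<open>Intersections of edges, degrees and the number of edges\<close>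

lemma edges_meet:
  assumes "e \<in> edges H" "f \<in> edges H" "e \<noteq> f"
  obtains x where "e \<inter> f = {x}"
proof -
  have "card (e \<inter> f) = 1" using assms one_intersecting by (simp add: one_intersecting_def)
  thus thesis using that by (auto simp: card_1_singleton_iff)
qed

lemma edges_meet_unique:
  assumes "e \<in> edges H" "f \<in> edges H" "e \<noteq> f" "x \<in> e" "x \<in> f" "y \<in> e" "y \<in> f"
  shows "x = y"
proof -
  obtain z where z: "e \<inter> f = {z}" using edges_meet[OF assms(1-3)] .
  have "x \<in> e \<inter> f" "y \<in> e \<inter> f" using assms(4-7) by blast+
  thus ?thesis by (simp add: z)
qed

text \<open>A vertex common to all edges would be the whole intersection of any two of them, hence
  the core of a sunflower.\<close>

lemma edge_avoiding:
  obtains f where "f \<in> edges H" "v \<notin> f"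
proof (rule ccontr)
  assume "\<not> thesis"
  hence all: "\<And>f. f \<in> edges H \<Longrightarrow> v \<in> f" using that by blast
  have "e \<inter> f = \<Inter>(edges H)" if "e \<in> edges H" "f \<in> edges H" "e \<noteq> f" for e f
  proof -
    have "e \<inter> f \<subseteq> {v}" using edges_meet_unique[OF that] that(1,2)[THEN all] by blast
    thus ?thesis using that all by blast
  qed
  thus False using non_sunflower by (auto simp: sunflower_def)
qed

text \<open>Take an edge \<open>f\<close> avoiding \<open>v\<close>. Every edge through
  \<open>v\<close> meets \<open>f\<close>, and no two of them do so in the same vertex, since they
  already share \<open>v\<close>.\<close>

lemma degree_le: "degree H v \<le> k"
proof -
  obtain f where f: "f \<in> edges H" "v \<notin> f" using edge_avoiding .
  have "{e\<in>edges H. v \<in> e} \<subseteq> (\<Union>u\<in>f. {e\<in>edges H. v \<in> e \<and> u \<in> e})"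
  proof
    fix e assume e: "e \<in> {e\<in>edges H. v \<in> e}"
    hence "e \<noteq> f" using f by auto
    then obtain x where "e \<inter> f = {x}" using edges_meet[of e f] e f by auto
    thus "e \<in> (\<Union>u\<in>f. {e\<in>edges H. v \<in> e \<and> u \<in> e})" using e by auto
  qed
  hence "degree H v \<le> card (\<Union>u\<in>f. {e\<in>edges H. v \<in> e \<and> u \<in> e})"
    unfolding degree_def using f by (intro card_mono) auto
  also have "\<dots> \<le> (\<Sum>u\<in>f. card {e\<in>edges H. v \<in> e \<and> u \<in> e})"
    using f by (intro card_UN_le) auto
  also have "\<dots> \<le> (\<Sum>u\<in>f. 1)"
  proof (rule sum_mono)
    fix u assume u: "u \<in> f"
    have "e = e'" if "e \<in> edges H" "v \<in> e" "u \<in> e" "e' \<in> edges H" "v \<in> e'" "u \<in> e'" for e e'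
      using edges_meet_unique[of e e' u v] that u f by auto
    thus "card {e\<in>edges H. v \<in> e \<and> u \<in> e} \<le> 1"
      by (auto simp: card_le_Suc0_iff_eq)
  qed
  finally show ?thesis using card_edge f by simp
qed

lemma degree_pos:
  assumes "v \<in> U"
  shows "1 \<le> degree H v"
proof -
  have "{e \<in> edges H. v \<in> e} \<noteq> {}" using assms by auto
  thus ?thesis by (simp add: degree_def Suc_le_eq card_gt_0_iff)
qed

text \<open>Each edge other than \<open>e\<close> meets \<open>e\<close> in exactly one vertex, and
  these vertices partition the other edges.\<close>

lemma sum_degree_edge:
  assumes "e \<in> edges H"
  shows "(\<Sum>v\<in>e. degree H v - 1) = m - 1"
proof -
  have "edges H - {e} = (\<Union>v\<in>e. {f\<in>edges H. v \<in> f} - {e})"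
  proof (intro equalityI subsetI)
    fix f assume f: "f \<in> edges H - {e}"
    then obtain x where "e \<inter> f = {x}" using edges_meet[of e f] assms by auto
    thus "f \<in> (\<Union>v\<in>e. {f\<in>edges H. v \<in> f} - {e})" using f by auto
  qed auto
  hence "m - 1 = card (\<Union>v\<in>e. {f\<in>edges H. v \<in> f} - {e})"
    using assms card_Diff_singleton[of e "edges H"] by simp
  also have "\<dots> = (\<Sum>v\<in>e. card ({f\<in>edges H. v \<in> f} - {e}))"
  proof (rule card_UN_disjoint)
    show "\<forall>u\<in>e. \<forall>v\<in>e. u \<noteq> v \<longrightarrow>
        ({f\<in>edges H. u \<in> f} - {e}) \<inter> ({f\<in>edges H. v \<in> f} - {e}) = {}"
      using edges_meet_unique[OF assms] by fast
  qed (use assms in simp_all)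
  also have "\<dots> = (\<Sum>v\<in>e. degree H v - 1)"
    using assms by (intro sum.cong) (auto simp: degree_def)
  finally show ?thesis by simp
qed

lemma card_edges_le: "m \<le> k\<^sup>2"
proof -
  obtain e where e: "e \<in> edges H" using edges_nonempty by blast
  show ?thesis
  proof (cases "k = 0")
    \<comment> \<open>The bound \<open>k * (k - 1) + 1\<close> used below exceeds
      \<open>k\<^sup>2\<close> at \<open>k = 0\<close>. Here only the empty edge is possible, and a
      single edge forms a sunflower.\<close>
    case True
    have "edges H \<subseteq> {{}}" using finite_edge card_edge True by fastforce
    then have "f = {}" if "f \<in> edges H" for f using that by blast
    hence "sunflower H" by (auto simp: sunflower_def)
    thus ?thesis using non_sunflower by simp
  next
    case False
    have "m - 1 \<le> (\<Sum>v\<in>e. k - 1)"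
      unfolding sum_degree_edge[OF e, symmetric] by (intro sum_mono diff_le_mono degree_le)
    hence "m - 1 \<le> k * (k - 1)" using card_edge[OF e] by simp
    hence "m \<le> k * (k - 1) + 1" by simp
    also have "\<dots> \<le> k\<^sup>2" using False by (cases k) (auto simp: power2_eq_square)
    finally show ?thesis .
  qed
qed

section \<open>Order and kernel size\<close>

lemma Ord_eq: "Ord H = card U"
proof -
  have "{v \<in> verts H. \<not> isolated H v} = U"
    using k_graph by (auto simp: isolated_def k_graph_def hypergraph_def)
  thus ?thesis by (simp add: Ord_def)
qed

text \<open>The common vertex of two distinct edges has degree at least 2, so it survives in both
  traces.\<close>

lemma kernel_degree_ge_2: "kernel H {v\<in>U. 2 \<le> degree H v}"
proof -
  let ?A = "{v\<in>U. 2 \<le> degree H v}"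
  have A: "?A \<inter> e \<inter> f \<noteq> {}" if ef: "e \<in> edges H" "f \<in> edges H" "e \<noteq> f" for e f
  proof -
    obtain x where x: "e \<inter> f = {x}" using edges_meet[OF ef] .
    have "card {e, f} \<le> degree H x"
      unfolding degree_def using ef x by (intro card_mono) auto
    hence "x \<in> ?A" using ef x by auto
    thus ?thesis using x by blast
  qed
  have other: "\<exists>f\<in>edges H. e \<noteq> f" for e
    using non_sunflower unfolding sunflower_def by blast
  have "?A \<subseteq> verts H" using k_graph by (auto simp: k_graph_def hypergraph_def)
  moreover have "?A \<inter> e \<noteq> {}" if "e \<in> edges H" for e
  proof -
    obtain f where "f \<in> edges H" "e \<noteq> f" using other by blast
    thus ?thesis using A[OF that] by (metis Int_empty_left)
  qed
  moreover have "intersecting (trace H ?A)"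
    unfolding intersecting_def
  proof (intro ballI impI)
    fix a b assume "a \<in> edges (trace H ?A)" "b \<in> edges (trace H ?A)" "a \<noteq> b"
    then obtain e f where "a = ?A \<inter> e" "b = ?A \<inter> f" "e \<in> edges H" "f \<in> edges H" "e \<noteq> f"
      by (auto simp: trace_def)
    thus "a \<inter> b \<noteq> {}" using A[of e f] by blast
  qed
  ultimately show ?thesis by (simp add: kernel_def)
qed

lemma Ker_le: "Ker H \<le> card {v\<in>U. 2 \<le> degree H v}"
  unfolding Ker_def
  by (rule Least_le) (use kernel_degree_ge_2 finite_U in \<open>auto intro!: exI[of _ "{v\<in>U. 2 \<le> degree H v}"]\<close>)

lemma sum_degree: "(\<Sum>v\<in>U. degree H v) = k * m"
  using sum_edges_sum_verts[of H "\<lambda>_. 1"] by (simp add: card_edge mult.commute)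

lemma Ord_Ker_le: "Ord H + Ker H + S \<le> k * m"
proof -
  \<comment> \<open>The summand equals the degree except at degree 0, which
    \<open>degree_pos\<close> excludes. Its three terms add up to \<open>S\<close>,
    \<open>Ord H\<close> and an upper bound for \<open>Ker H\<close>.\<close>
  have "k * m = (\<Sum>v\<in>U. (degree H v - 2) + 1 + (if 2 \<le> degree H v then 1 else 0))"
    unfolding sum_degree[symmetric] using degree_pos by (intro sum.cong) fastforce+
  also have "\<dots> = S + card U + card {v\<in>U. 2 \<le> degree H v}"
    by (simp only: sum.distrib sum.inter_filter[OF finite_U, symmetric] card_eq_sum)
  finally show ?thesis using Ord_eq Ker_le by linarith
qed

section \<open>Lower bounds for \<open>S\<close>\<close>

lemma sum_degree_pairs: "(\<Sum>v\<in>U. degree H v * (degree H v - 1)) = m * (m - 1)"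
  \<comment> \<open>Both sides count ordered pairs of distinct edges, the left one by their common
    vertex.\<close>
  using sum_edges_sum_verts[of H "\<lambda>v. degree H v - 1"] sum_degree_edge by simp

lemma S_ge_small_degrees:
  fixes x :: real
  assumes "0 \<le> x" "\<And>v. v \<in> U \<Longrightarrow> real (degree H v) \<le> x"
  shows "real m * (real m - 1) \<le> x * real S + real k * real m"
proof -
  have "real m * (real m - 1) = real (m * (m - 1))"
    by (cases m) (auto simp: algebra_simps)
  also have "\<dots> = (\<Sum>v\<in>U. real (degree H v * (degree H v - 1)))"
    by (simp only: sum_degree_pairs[symmetric] of_nat_sum)
  also have "\<dots> \<le> (\<Sum>v\<in>U. x * real (degree H v - 2) + real (degree H v))"
  proof (rule sum_mono)
    fix v assume v: "v \<in> U"
    \<comment> \<open>Equality holds for degrees at least 2; at degree 1 truncation leaves a slack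
      of 1.\<close>
    have "degree H v * (degree H v - 1) \<le> degree H v * (degree H v - 2) + degree H v"
      by (cases "degree H v"; cases "degree H v - 1") (auto simp: algebra_simps)
    hence "real (degree H v * (degree H v - 1)) \<le> real (degree H v) * real (degree H v - 2) + real (degree H v)"
      by (metis of_nat_add of_nat_le_iff of_nat_mult)
    also have "\<dots> \<le> x * real (degree H v - 2) + real (degree H v)"
      using assms v by (intro add_mono mult_right_mono) auto
    finally show "real (degree H v * (degree H v - 1)) \<le> x * real (degree H v - 2) + real (degree H v)" .
  qed
  also have "\<dots> = x * real S + real (\<Sum>v\<in>U. degree H v)"
    by (simp add: sum.distrib sum_distrib_left)
  finally show ?thesis by (simp add: sum_degree)
qed

lemma S_ge_vertex:
  "degree H v * (m - degree H v) \<le> S + degree H v * k"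
proof -
  let ?F = "{f\<in>edges H. v \<in> f}"
  \<comment> \<open>Over \<open>f - {v}\<close> the values \<open>degree H u - 1\<close> sum to
    \<open>m - degree H v\<close>. Lowering each to \<open>degree H u - 2\<close> costs at most 1
    per vertex, hence at most \<open>k\<close>.\<close>
  have edge: "m - degree H v \<le> (\<Sum>u\<in>f - {v}. degree H u - 2) + k" if f: "f \<in> ?F" for f
  proof -
    have "m - 1 = (degree H v - 1) + (\<Sum>u\<in>f - {v}. degree H u - 1)"
      using sum_degree_edge[of f] sum.remove[of f v "\<lambda>u. degree H u - 1"] f by auto
    moreover have "(\<Sum>u\<in>f - {v}. degree H u - 1) \<le> (\<Sum>u\<in>f - {v}. (degree H u - 2) + 1)"
      by (rule sum_mono) simp
    moreover have "card (f - {v}) \<le> k" using f card_edge by (metis (lifting) card_Diff1_le mem_Collect_eq)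
    moreover have "1 \<le> degree H v" using f by (intro degree_pos) auto
    ultimately show ?thesis unfolding sum.distrib by simp
  qed
  have "degree H v * (m - degree H v) = (\<Sum>f\<in>?F. m - degree H v)"
    by (simp add: degree_def)
  also have "\<dots> \<le> (\<Sum>f\<in>?F. (\<Sum>u\<in>f - {v}. degree H u - 2) + k)"
    using edge by (rule sum_mono)
  also have "\<dots> = (\<Sum>f\<in>?F. \<Sum>u\<in>f - {v}. degree H u - 2) + degree H v * k"
    by (simp add: sum.distrib degree_def)
  also have "(\<Sum>f\<in>?F. \<Sum>u\<in>f - {v}. degree H u - 2) = (\<Sum>u\<in>(\<Union>f\<in>?F. f - {v}). degree H u - 2)"
  proof (rule sum.UNION_disjoint[symmetric])
    show "\<forall>e\<in>?F. \<forall>f\<in>?F. e \<noteq> f \<longrightarrow> (e - {v}) \<inter> (f - {v}) = {}"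
      using edges_meet_unique[where y = v] by fast
  qed simp_all
  also have "\<dots> \<le> S"
    using finite_U by (intro sum_mono2) auto
  finally show ?thesis by simp
qed

text \<open>The loss consists of two terms of size at most \<open>k\<^sup>2\<close>:
  \<open>x\<close> and \<open>k * x\<close> if no degree exceeds \<open>x\<close>, otherwise
  \<open>D * k\<close> and \<open>D * D\<close>.\<close>

lemma S_ge: "sqrt (real m) ^ 3 - 2 * (real k)\<^sup>2 \<le> real S"
proof -
  define x where "x = sqrt (real m)"
  have x2: "x\<^sup>2 = real m" and x0: "0 \<le> x" by (simp_all add: x_def)
  have xk: "x \<le> real k"
    unfolding x_def using card_edges_le by (intro real_le_lsqrt) (simp_all flip: of_nat_power)
  show ?thesis
  proof (cases "\<forall>v\<in>U. real (degree H v) \<le> x")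
    case True
    have "0 < m" using edges_nonempty by (simp add: card_gt_0_iff)
    \<comment> \<open>\<open>0 < x\<close> allows cancelling a factor; \<open>1 \<le> x\<close>
      gives \<open>1 \<le> k\<close>, used to bound \<open>x\<close> by
      \<open>k * k\<close>.\<close>
    hence xpos: "0 < x" and x1: "1 \<le> x" by (simp_all add: x_def)
    have "x\<^sup>2 * (x\<^sup>2 - 1) \<le> x * real S + real k * x\<^sup>2"
      unfolding x2 using S_ge_small_degrees[OF x0] True by blast
    hence "x * (x * (x\<^sup>2 - 1)) \<le> x * (real S + real k * x)"
      by (simp add: power2_eq_square algebra_simps)
    hence "x * (x\<^sup>2 - 1) \<le> real S + real k * x" using xpos by simp
    hence "x ^ 3 \<le> real S + x * 1 + real k * x"
      by (simp add: power2_eq_square power3_eq_cube algebra_simps)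
    also have "x * 1 \<le> real k * real k" using xk x0 x1 by (intro mult_mono) auto
    also have "real k * x \<le> real k * real k" using xk by (intro mult_left_mono) auto
    finally show ?thesis by (simp add: x_def power2_eq_square)
  next
    case False
    then obtain v where v: "x < real (degree H v)" by (meson not_le)
    define D where "D = degree H v"
    have D: "x \<le> real D" "real D \<le> real k" using v degree_le by (auto simp: D_def)
    have "D \<le> m" unfolding D_def degree_def by (intro card_mono) auto
    have "real (D * (m - D)) \<le> real (S + D * k)"
      unfolding D_def of_nat_le_iff by (rule S_ge_vertex)
    hence "real D * x\<^sup>2 \<le> real S + real D * real k + real D * real D"
      unfolding x2 using \<open>D \<le> m\<close> by (simp add: of_nat_diff algebra_simps)
    moreover have "x * x\<^sup>2 \<le> real D * x\<^sup>2" using D by (intro mult_right_mono) auto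
    moreover have "real D * real k \<le> real k * real k" "real D * real D \<le> real k * real k"
      using D by (intro mult_mono; simp)+
    ultimately show ?thesis by (simp add: x_def power2_eq_square power3_eq_cube mult.commute)
  qed
qed

end

section \<open>The cubic bound and the conclusion\<close>

lemma cubic_max:
  fixes a x :: real
  assumes "0 \<le> a" "0 \<le> x"
  shows "a * x\<^sup>2 - x ^ 3 \<le> 4 / 27 * a ^ 3"
proof -
  \<comment> \<open>The maximum is at \<open>x = 2 / 3 * a\<close>, a double root of the difference
    of the two sides; the third root is \<open>- a / 3\<close>.\<close>
  have "0 \<le> (x - 2 / 3 * a)\<^sup>2 * (x + a / 3)" using assms by simp
  also have "\<dots> = 4 / 27 * a ^ 3 - (a * x\<^sup>2 - x ^ 3)"
    by (simp add: power2_eq_square power3_eq_cube field_simps)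
  finally show ?thesis by simp
qed

theorem theorem3p1:
  fixes k :: nat and H :: "'a hypergraph"
  assumes "0 < k"
    and "k_graph k H"
    and "one_intersecting H"
    and "\<not> sunflower H"
  shows "real (Ord H) + real (Ker H) \<le> 4 / 27 * real k ^ 3 + 4 * real k powr (5 / 2)"
proof -
  interpret one_intersecting_non_sunflower k H by unfold_locales (use assms in auto)
  define x where "x = sqrt (real m)"
  have x: "0 \<le> x" "x\<^sup>2 = real m" by (simp_all add: x_def)
  have "real (Ord H + Ker H + S) \<le> real (k * m)"
    using Ord_Ker_le by (simp only: of_nat_le_iff)
  hence "real (Ord H) + real (Ker H) \<le> real k * x\<^sup>2 - real S" using x by simp
  also have "\<dots> \<le> real k * x\<^sup>2 - x ^ 3 + 2 * (real k)\<^sup>2" using S_ge by (simp add: x_def)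
  also have "\<dots> \<le> 4 / 27 * real k ^ 3 + 2 * (real k)\<^sup>2" using cubic_max[OF of_nat_0_le_iff x(1)] by simp
  \<comment> \<open>As \<open>k\<close> is at least 1, the error \<open>2 * (real k)\<^sup>2\<close>
    is at most half of the allowed one.\<close>
  also have "(real k)\<^sup>2 = real k powr 2" using assms(1) by simp
  also have "\<dots> \<le> real k powr (5 / 2)" using assms(1) by (intro powr_mono) auto
  finally show ?thesis using powr_ge_zero[of "real k" "5 / 2"] by linarith
qed

end
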